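(* Let $C$ be a Reuleaux polygon which is symmetric about a line $\ell$ in its plane, and let $K\subset\mathbb{R}^3$ be the (axially symmetric) constant width body generated by $C$, i.e. obtained by rotating $C$ about $\ell$. Then $K$ is extreme.
   Context: A convex body in $\mathbb{R}^n$ (compact convex set) has constant width if the distance between any pair of parallel supporting hyperplanes is the same; throughout, "constant width" means constant width equal to $1$. A planar constant width shape is identified with its boundary curve (a constant width curve). A constant width $K\subset\mathbb{R}^n$ is extreme if $K\neq(1-\lambda)K_0+\lambda K_1$ (Minkowski combination) for all $\lambda\in(0,1)$ and all constant width $K_0,K_1\subset\mathbb{R}^n$ which are not translates of each other. A Reuleaux polygon is a constant width curve (equivalently, the planar constant width shape it bounds) consisting of finitely many circular arcs of radius one. If $C$ is a planar constant width shape lying in a plane in $\mathbb{R}^3$ and symmetric about a line $\ell$ in that plane, then rotating $C$ about $\ell$ yields a constant width body $K\subset\mathbb{R}^3$; one says $C$ generates $K$. In coordinates where the plane is the $y_1y_3$-plane and $\ell$ is the $y_3$-axis, $K=\{y\in\mathbb{R}^3:(\sqrt{y_1^2+y_2^2},\,y_3)\in C\}$. *)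

theory Defs
  imports "HOL-Analysis.Analysis"
begin

text \<open>
  \<open>H\<close> is the hyperplane supporting \<open>K\<close> with outer normal \<open>u\<close>. A pair of parallel supporting
  hyperplanes of \<open>K\<close> is a pair with opposite outer normals; the two may coincide if \<open>K\<close> is flat.
\<close>

definition supporting_hyperplane :: "'a::euclidean_space set \<Rightarrow> 'a \<Rightarrow> 'a set \<Rightarrow> bool" where
  "supporting_hyperplane K u H \<longleftrightarrow>
     u \<noteq> 0 \<and> (\<exists>c. H = {x. u \<bullet> x = c} \<and> K \<subseteq> {x. u \<bullet> x \<le> c}) \<and> K \<inter> H \<noteq> {}"

text \<open>Constant width is normalised to width \<open>1\<close>.\<close>

definition constant_width :: "'a::euclidean_space set \<Rightarrow> bool" where
  "constant_width K \<longleftrightarrow> compact K \<and> convex K \<and> K \<noteq> {} \<and>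
     (\<forall>u H H'. supporting_hyperplane K u H \<longrightarrow> supporting_hyperplane K (- u) H' \<longrightarrow>
        setdist H H' = 1)"

definition minkowski_combination ::
    "real \<Rightarrow> 'a::euclidean_space set \<Rightarrow> 'a set \<Rightarrow> 'a set" where
  "minkowski_combination t K0 K1 = {(1 - t) *\<^sub>R x + t *\<^sub>R y | x y. x \<in> K0 \<and> y \<in> K1}"

definition translates :: "'a::euclidean_space set \<Rightarrow> 'a set \<Rightarrow> bool" where
  "translates K0 K1 \<longleftrightarrow> (\<exists>a. K1 = (+) a ` K0)"

definition extreme_constant_width :: "'a::euclidean_space set \<Rightarrow> bool" where
  "extreme_constant_width K \<longleftrightarrow> constant_width K \<and>
     (\<forall>t K0 K1. 0 < t \<and> t < 1 \<and> constant_width K0 \<and> constant_width K1 \<and> \<not> translates K0 K1 \<longrightarrow>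
        K \<noteq> minkowski_combination t K0 K1)"

definition unit_circular_arc :: "(real^2) set \<Rightarrow> bool" where
  "unit_circular_arc A \<longleftrightarrow>
     (\<exists>c a b. a < b \<and> b < a + 2 * pi \<and> A = {c + vector [cos t, sin t] | t. a \<le> t \<and> t \<le> b})"

text \<open>
  A constant width curve is represented by the shape that it bounds, so the curve itself is the
  frontier.
\<close>

definition reuleaux_polygon :: "(real^2) set \<Rightarrow> bool" where
  "reuleaux_polygon C \<longleftrightarrow> constant_width C \<and>
     (\<exists>\<A>. finite \<A> \<and> (\<forall>A\<in>\<A>. unit_circular_arc A) \<and> frontier C = \<Union>\<A>)"

definition line :: "'a::euclidean_space set \<Rightarrow> bool" where
  "line L \<longleftrightarrow> affine L \<and> aff_dim L = 1"

definition reflection :: "'a::euclidean_space set \<Rightarrow> 'a \<Rightarrow> 'a" where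
  "reflection L x = 2 *\<^sub>R closest_point L x - x"

definition symmetric_about :: "'a::euclidean_space set \<Rightarrow> 'a set \<Rightarrow> bool" where
  "symmetric_about L S \<longleftrightarrow> reflection L ` S = S"

text \<open>
  Planar shapes live in \<open>real^2\<close>. A planar shape \<open>C\<close> with axis \<open>L\<close> is placed in a plane of \<open>real^3\<close> by a
  distance-preserving map \<open>f\<close>, and then generates \<open>body_of_revolution (f ` L) (f ` C)\<close>.
\<close>

definition rotation_about :: "(real^3) set \<Rightarrow> (real^3 \<Rightarrow> real^3) \<Rightarrow> bool" where
  "rotation_about L T \<longleftrightarrow>
     (\<exists>A p. rotation_matrix A \<and> T = (\<lambda>x. p + A *v (x - p))) \<and> (\<forall>x\<in>L. T x = x)"

definition body_of_revolution :: "(real^3) set \<Rightarrow> (real^3) set \<Rightarrow> (real^3) set" where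
  "body_of_revolution L S = {T x | T x. rotation_about L T \<and> x \<in> S}"

lemma closest_point_axis: "closest_point {x::real^2. x$1 = 0} x = vector [0, x$2]"
proof (rule closest_point_unique[symmetric])
  let ?L = "{x::real^2. x$1 = 0}"
  show "convex ?L" by (auto simp: convex_def)
  show "closed ?L" by (intro closed_Collect_eq continuous_intros)
  show "vector [0, x$2] \<in> ?L" by simp
  show "\<forall>z\<in>?L. dist x (vector [0, x$2]) \<le> dist x z"
    by (auto simp: dist_norm norm_vec_def L2_set_def sum_2)
qed

lemma dist_rotation_about:
  assumes "rotation_about L T" shows "dist (T x) (T y) = dist x y"
proof -
  from assms obtain A p where A: "orthogonal_matrix A" "T = (\<lambda>x. p + A *v (x - p))"
    by (auto simp: rotation_about_def rotation_matrix_def)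
  have "T x - T y = A *v (x - y)" by (simp add: A(2) matrix_vector_mult_diff_distrib)
  then show ?thesis
    using A(1) by (simp add: dist_norm orthogonal_transformation_norm
        orthogonal_transformation_matrix matrix_of_matrix_vector_mul)
qed

text \<open>
  In coordinates in which the plane is the \<open>y\<^sub>1y\<^sub>3\<close>-plane and the axis is the \<open>y\<^sub>3\<close>-axis, the body of
  revolution is given by the usual formula.
\<close>

lemma body_of_revolution_coordinates:
  fixes C :: "(real^2) set"
  defines "L \<equiv> {x::real^2. x$1 = 0}" and "f \<equiv> (\<lambda>x::real^2. vector [x$1, 0, x$2] :: real^3)"
  assumes "symmetric_about L C"
  shows "body_of_revolution (f ` L) (f ` C) = {y. vector [sqrt ((y$1)^2 + (y$2)^2), y$3] \<in> C}"
    (is "?B = ?R")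
proof (intro equalityI subsetI)
  fix y assume "y \<in> ?B"
  then obtain T x where T: "rotation_about (f ` L) T" and x: "x \<in> C" and y: "y = T (f x)"
    by (auto simp: body_of_revolution_def)
  have "0 \<in> L" "vector [0,1] \<in> L" by (auto simp: L_def)
  then have fx: "T (f 0) = f 0" "T (f (vector [0,1])) = f (vector [0,1])"
    using T by (auto simp: rotation_about_def)
  have "dist y (f 0) = dist (f x) (f 0)" "dist y (f (vector [0,1])) = dist (f x) (f (vector [0,1]))"
    using dist_rotation_about[OF T] fx y by metis+
  then have e: "(y$1)^2 + (y$2)^2 + (y$3)^2 = (x$1)^2 + (x$2)^2"
       "(y$1)^2 + (y$2)^2 + (y$3 - 1)^2 = (x$1)^2 + (x$2 - 1)^2"
    by (simp_all add: dist_norm norm_vec_def L2_set_def sum_3 f_def vector_3)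
  then have e3: "y$3 = x$2" by (simp add: power2_eq_square algebra_simps)
  then have e1: "sqrt ((y$1)^2 + (y$2)^2) = \<bar>x$1\<bar>" using e by simp
  have "reflection L x \<in> C" using assms(3) x by (auto simp: symmetric_about_def)
  moreover have "reflection L x = vector [- x$1, x$2]"
    unfolding reflection_def L_def closest_point_axis by (simp add: vec_eq_iff forall_2)
  moreover have "x = vector [x$1, x$2]" by (simp add: vec_eq_iff forall_2)
  ultimately show "y \<in> ?R" using x e1 e3 by (auto simp: abs_if)
next
  fix y assume y: "y \<in> ?R"
  define r where "r = sqrt ((y$1)^2 + (y$2)^2)"
  have "\<exists>a. y$1 = r * cos a \<and> y$2 = r * sin a"
  proof -
    have "Complex (y$1) (y$2) = rcis r (Arg (Complex (y$1) (y$2)))"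
      using rcis_cmod_Arg[of "Complex (y$1) (y$2)"] by (simp add: r_def complex_norm)
    then show ?thesis by (metis Re_rcis Im_rcis complex.sel)
  qed
  then obtain a where a: "y$1 = r * cos a" "y$2 = r * sin a" by auto
  define A :: "real^3^3" where
    "A = vector [vector [cos a, - sin a, 0], vector [sin a, cos a, 0], vector [0, 0, 1]]"
  have cs: "cos a * cos a + sin a * sin a = 1"
    using sin_cos_squared_add3[of a] by simp
  have "rotation_matrix A"
    using cs by (auto simp: rotation_matrix_def orthogonal_matrix A_def matrix_matrix_mult_def
        transpose_def mat_def vec_eq_iff forall_3 sum_3 vector_3 det_3 algebra_simps)
  moreover have "\<forall>x\<in>f ` L. A *v x = x"
    by (auto simp: A_def L_def f_def matrix_vector_mult_def vec_eq_iff forall_3 sum_3 vector_3)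
  ultimately have "rotation_about (f ` L) (\<lambda>x. A *v x)"
    unfolding rotation_about_def by (intro conjI exI[of _ A] exI[of _ 0]) auto
  moreover have "y = A *v (f (vector [r, y$3]))"
    using a by (auto simp: A_def f_def matrix_vector_mult_def vec_eq_iff forall_3 sum_3 vector_3)
  ultimately show "y \<in> ?B" using y unfolding body_of_revolution_def r_def by blast
qed

end

theory Submission
  imports Defs
begin

text \<open>
  In every direction \<open>u\<close> a body \<open>K\<close> of constant width has exactly one boundary point with outer normal
  \<open>u\<close>; call it \<open>p\<^sub>K u\<close>. It depends continuously on \<open>u\<close>, satisfies \<open>p\<^sub>K (- u) = p\<^sub>K u - u\<close>, and is additive
  under Minkowski combinations. Suppose \<open>K = (1 - t) K\<^sub>0 + t K\<^sub>1\<close> and put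
  \<open>\<delta> u = p\<^sub>K\<^sub>1 u - p\<^sub>K\<^sub>0 u\<close>. If \<open>\<delta>\<close> is constant, then \<open>K\<^sub>0\<close> and \<open>K\<^sub>1\<close> are translates of each other, since
  their support functions differ by a linear function.

  Call a boundary point \<open>c\<close> of \<open>K\<close> a corner for all the directions \<open>u\<close> with \<open>p\<^sub>K u = c\<close>. A corner of \<open>K\<close> comes
  from corners of \<open>K\<^sub>0\<close> and \<open>K\<^sub>1\<close> for the same directions: passing from \<open>u\<close> to another of them, \<open>v\<close>, cannot
  increase the heights \<open>u \<bullet> p\<^sub>K\<^sub>0\<close> and \<open>u \<bullet> p\<^sub>K\<^sub>1\<close>, and as their weighted sum stays the same, neither changes
  (\<open>support_map_eq_if_common_support_point\<close>). So \<open>\<delta>\<close> takes only one value on these directions, and by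
  \<open>\<delta> (- u) = \<delta> u\<close> the same value on their opposites. Hence, if finitely many corners serve a connected
  set of directions up to sign, then \<open>\<delta>\<close> has a finite and connected range on this set and is constant there
  (\<open>support_map_difference_constant\<close>).

  A Reuleaux polygon is of this kind for the whole circle of directions: in each direction \<open>u\<close> the boundary
  point either is an end of one of the arcs or lies inside an arc, and then its opposite point is the
  centre of that arc (\<open>reuleaux_polygon_corners\<close>).

  The body of revolution is the union of the copies of \<open>C\<close> in the planes through the axis. By symmetry and
  convexity of \<open>C\<close>, its orthogonal projection to each plane through the axis is also the copy of \<open>C\<close> in
  that plane. Therefore each such copy has, for directions in its plane, the same boundary points
  as the whole body (\<open>support_point_revolve\<close>). This shows that the body has constant width and that
  finitely many corners serve each great circle through the direction \<open>e\<close> of the axis. So \<open>\<delta> u = \<delta> e\<close> on each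
  of these circles, and they cover the sphere.
\<close>

section \<open>Support points of bodies of constant width\<close>

definition support_point :: "'a::euclidean_space set \<Rightarrow> 'a \<Rightarrow> 'a \<Rightarrow> bool" where
  "support_point K u p \<longleftrightarrow> p \<in> K \<and> (\<forall>x\<in>K. u \<bullet> x \<le> u \<bullet> p)"

lemma support_point_exists:
  assumes "compact K" "K \<noteq> {}"
  obtains p where "support_point K u p"
proof -
  have "continuous_on K (\<lambda>x. u \<bullet> x)" by (intro continuous_intros)
  from continuous_attains_sup[OF assms this] show ?thesis
    using that unfolding support_point_def by blast
qed

lemma support_point_scaleR:
  assumes "r > 0"
  shows "support_point K (r *\<^sub>R u) p \<longleftrightarrow> support_point K u p"
  using assms by (simp add: support_point_def)

lemma supporting_hyperplane_iff_support_point: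
  "supporting_hyperplane K u H \<longleftrightarrow>
     u \<noteq> 0 \<and> (\<exists>p. support_point K u p \<and> H = {x. u \<bullet> x = u \<bullet> p})"
  unfolding supporting_hyperplane_def support_point_def by auto

lemma setdist_parallel_hyperplanes:
  fixes u :: "'a::euclidean_space"
  assumes "u \<noteq> 0"
  shows "setdist {x. u \<bullet> x = a} {x. u \<bullet> x = b} = \<bar>a - b\<bar> / norm u"
proof (rule antisym)
  let ?x = "\<lambda>c. (c / (u \<bullet> u)) *\<^sub>R u"
  have "setdist {x. u \<bullet> x = a} {x. u \<bullet> x = b} \<le> dist (?x a) (?x b)"
    using assms by (intro setdist_le_dist) auto
  also have "?x a - ?x b = ((a - b) / (u \<bullet> u)) *\<^sub>R u"
    by (simp add: scaleR_left_diff_distrib diff_divide_distrib)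
  then have "dist (?x a) (?x b) = \<bar>a - b\<bar> / norm u"
    using assms by (simp add: dist_norm power2_norm_eq_inner[symmetric] power2_eq_square)
  finally show "setdist {x. u \<bullet> x = a} {x. u \<bullet> x = b} \<le> \<bar>a - b\<bar> / norm u" .
next
  show "\<bar>a - b\<bar> / norm u \<le> setdist {x. u \<bullet> x = a} {x. u \<bullet> x = b}"
  proof (rule le_setdistI)
    have "u \<bullet> ((c / (u \<bullet> u)) *\<^sub>R u) = c" for c using assms by simp
    then show "{x. u \<bullet> x = a} \<noteq> {}" "{x. u \<bullet> x = b} \<noteq> {}" by blast+
    fix x y assume "x \<in> {x. u \<bullet> x = a}" "y \<in> {x. u \<bullet> x = b}"
    then have "\<bar>a - b\<bar> = \<bar>u \<bullet> (x - y)\<bar>" by (simp add: inner_diff_right)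
    also have "\<dots> \<le> norm u * norm (x - y)" by (rule Cauchy_Schwarz_ineq2)
    finally show "\<bar>a - b\<bar> / norm u \<le> dist x y"
      using assms by (simp add: dist_norm divide_le_eq mult.commute)
  qed
qed

text \<open>
  The half of the definition of constant width that yields information: the hyperplanes through \<open>p\<close> and
  \<open>q\<close> orthogonal to \<open>u\<close> are at distance \<open>u \<bullet> (p - q)\<close>.
\<close>

lemma constant_width_inner_support_points:
  assumes K: "constant_width K" and u: "norm u = 1"
    and p: "support_point K u p" and q: "support_point K (- u) q"
  shows "u \<bullet> (p - q) = 1"
proof -
  have "u \<noteq> 0" using u by auto
  then have "setdist {x. u \<bullet> x = u \<bullet> p} {x. - u \<bullet> x = - u \<bullet> q} = 1"
    using K p q unfolding constant_width_def supporting_hyperplane_iff_support_point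
    by (metis neg_equal_0_iff_equal)
  moreover have "{x. - u \<bullet> x = - u \<bullet> q} = {x. u \<bullet> x = u \<bullet> q}" by simp
  moreover have "u \<bullet> q \<le> u \<bullet> p" using p q by (simp add: support_point_def)
  ultimately show ?thesis
    using setdist_parallel_hyperplanes[OF \<open>u \<noteq> 0\<close>, of "u \<bullet> p" "u \<bullet> q"] u
    by (simp add: inner_diff_right)
qed

text \<open>
  Two points of \<open>K\<close> lie between the supporting hyperplanes orthogonal to the line through them, and
  these are at distance \<open>1\<close>.
\<close>

lemma constant_width_norm_diff_le:
  assumes K: "constant_width K" and x: "x \<in> K" and y: "y \<in> K"
  shows "norm (x - y) \<le> 1"
proof (cases "x = y")
  case False
  define v where "v = (x - y) /\<^sub>R norm (x - y)"
  have v: "norm v = 1" using False by (simp add: v_def)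
  have "compact K" "K \<noteq> {}" using K by (auto simp: constant_width_def)
  then obtain p q where pq: "support_point K v p" "support_point K (- v) q"
    by (metis support_point_exists)
  have "norm (x - y) = v \<bullet> (x - y)"
    using False by (simp add: v_def power2_norm_eq_inner[symmetric] power2_eq_square)
  also have "\<dots> \<le> v \<bullet> (p - q)"
    using pq x y by (simp add: support_point_def inner_diff_right) (meson diff_mono)
  also have "\<dots> = 1" by (rule constant_width_inner_support_points[OF K v pq])
  finally show ?thesis .
qed simp

text \<open>
  The two points have distance at most \<open>1\<close>, and their difference has component \<open>1\<close> along \<open>u\<close>, so
  there is equality in the Cauchy-Schwarz inequality.
\<close>

lemma constant_width_opposite_support_points:
  assumes K: "constant_width K" and u: "norm u = 1"
    and p: "support_point K u p" and q: "support_point K (- u) q"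
  shows "p - q = u"
proof -
  have 1: "u \<bullet> (p - q) = 1" by (rule constant_width_inner_support_points[OF assms])
  have "norm (p - q) \<le> 1"
    using K p q by (intro constant_width_norm_diff_le) (auto simp: support_point_def)
  then have "(norm (p - q))\<^sup>2 \<le> 1" by (simp add: power_le_one)
  then have "(norm (p - q - u))\<^sup>2 \<le> 0"
    using 1 u by (simp add: power2_norm_eq_inner inner_diff_left inner_diff_right inner_commute norm_eq_1)
  then show ?thesis by simp
qed

lemma constant_width_support_point_unique:
  assumes K: "constant_width K" and u: "norm u = 1"
    and p: "support_point K u p" "support_point K u p'"
  shows "p = p'"
proof -
  have "compact K" "K \<noteq> {}" using K by (auto simp: constant_width_def)
  then obtain q where "support_point K (- u) q" by (metis support_point_exists)
  then show ?thesis
    using constant_width_opposite_support_points[OF K u] p by (metis diff_add_cancel)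
qed

lemma support_point_opposite:
  assumes K: "constant_width K" and u: "norm u = 1" and p: "support_point K u p"
  shows "support_point K (- u) (p - u)"
proof -
  have "compact K" "K \<noteq> {}" using K by (auto simp: constant_width_def)
  then obtain q where q: "support_point K (- u) q" by (metis support_point_exists)
  then have "q = p - u" using constant_width_opposite_support_points[OF K u p] by force
  then show ?thesis using q by simp
qed

text \<open>
  A criterion that exhibits opposite boundary points instead of computing distances of hyperplanes.
\<close>

lemma constant_widthI:
  assumes "compact K" "convex K" "K \<noteq> {}"
    and "\<And>u. norm u = 1 \<Longrightarrow> \<exists>p. support_point K u p \<and> support_point K (- u) (p - u)"
  shows "constant_width K"
  unfolding constant_width_def
proof (intro conjI allI impI assms)
  fix u H H' assume "supporting_hyperplane K u H" "supporting_hyperplane K (- u) H'"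
  then obtain p q where u: "u \<noteq> 0"
    and p: "support_point K u p" "H = {x. u \<bullet> x = u \<bullet> p}"
    and q: "support_point K (- u) q" "H' = {x. (- u) \<bullet> x = (- u) \<bullet> q}"
    by (auto simp: supporting_hyperplane_iff_support_point)
  let ?u = "u /\<^sub>R norm u"
  obtain p' where "support_point K ?u p'" "support_point K (- ?u) (p' - ?u)"
    using assms(4)[of ?u] u by auto
  then have p': "support_point K u p'" "support_point K (- u) (p' - ?u)"
    using u support_point_scaleR[of "inverse (norm u)" K u] 
      support_point_scaleR[of "inverse (norm u)" K "- u"] by auto
  have "u \<bullet> p = u \<bullet> p'" "u \<bullet> q = u \<bullet> (p' - ?u)"
    using p(1) q(1) p' by (auto simp: support_point_def intro!: antisym)
  then have "u \<bullet> p - u \<bullet> q = norm u"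
    using u by (simp add: inner_diff_right power2_norm_eq_inner[symmetric] power2_eq_square)
  then show "setdist H H' = 1"
    using setdist_parallel_hyperplanes[OF u, of "u \<bullet> p" "u \<bullet> q"] p(2) q(2) u by simp
qed

text \<open>
  This inverse of the Gauss map is, on a body of constant width and away from the origin, the gradient of
  the support function.
\<close>

definition support_map :: "'a::euclidean_space set \<Rightarrow> 'a \<Rightarrow> 'a" where
  "support_map K u = (SOME p. support_point K u p)"

lemma support_map:
  assumes "constant_width K"
  shows "support_point K u (support_map K u)"
  using assms support_point_exists[of K u] unfolding support_map_def constant_width_def
  by (metis someI)

lemma support_map_eq:
  assumes "constant_width K" "norm u = 1" "support_point K u p"
  shows "support_map K u = p"
  using constant_width_support_point_unique assms support_map by blast

lemma support_map_minus:
  assumes "constant_width K" "norm u = 1"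
  shows "support_map K (- u) = support_map K u - u"
  using assms by (intro support_map_eq support_point_opposite support_map) auto

text \<open>
  A body of constant width lies in the unit ball around each of its points, in particular around the
  point opposite to \<open>support_map K u\<close>. Adding the two inequalities that express this for the
  directions \<open>u\<close> and \<open>v\<close> gives the bound.
\<close>

lemma support_map_lipschitz:
  assumes K: "constant_width K" and u: "norm u = 1" and v: "norm v = 1"
  shows "norm (support_map K u - support_map K v) \<le> norm (u - v)"
proof -
  let ?p = "support_map K"
  define d where "d = ?p u - ?p v"
  have mem: "?p w \<in> K" for w using support_map[OF K] by (simp add: support_point_def)
  have "norm (?p u - ?p (- v)) \<le> 1" "norm (?p (- u) - ?p v) \<le> 1"
    by (intro constant_width_norm_diff_le[OF K] mem)+
  moreover have "?p u - ?p (- v) = d + v" "?p (- u) - ?p v = d - u"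
    by (simp_all add: support_map_minus K u v d_def)
  ultimately have "(norm (d + v))\<^sup>2 \<le> 1" "(norm (d - u))\<^sup>2 \<le> 1"
    by (simp_all add: power_le_one)
  then have "d \<bullet> d \<le> d \<bullet> (u - v)"
    using u v by (simp add: power2_norm_eq_inner inner_diff_left inner_diff_right inner_add_left
        inner_add_right inner_commute norm_eq_1)
  also have "\<dots> \<le> norm d * norm (u - v)" by (rule norm_cauchy_schwarz)
  finally have "norm d * norm d \<le> norm d * norm (u - v)"
    by (simp add: power2_norm_eq_inner[symmetric] power2_eq_square)
  then show ?thesis unfolding d_def[symmetric] by (cases "d = 0") auto
qed

lemma continuous_on_support_map:
  assumes "constant_width K"
  shows "continuous_on (sphere 0 1) (support_map K)"
proof -
  have "1-lipschitz_on (sphere 0 1) (support_map K)"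
    using support_map_lipschitz[OF assms] by (intro lipschitz_onI) (auto simp: dist_norm)
  then show ?thesis by (rule lipschitz_on_continuous_on)
qed

text \<open>
  \<open>K\<close> is the intersection of its half-spaces, and the hypothesis puts \<open>M\<close> in each of them.
\<close>

lemma subset_if_support_points_mem:
  assumes K: "compact K" "convex K" "K \<noteq> {}"
    and M: "\<And>u. norm u = 1 \<Longrightarrow> \<exists>p\<in>K. support_point M u p"
  shows "M \<subseteq> K"
proof (rule ccontr)
  assume "\<not> M \<subseteq> K"
  then obtain y where y: "y \<in> M" "y \<notin> K" by auto
  obtain a b where ab: "a \<bullet> y < b" "\<forall>x\<in>K. b < a \<bullet> x"
    using separating_hyperplane_closed_point[of K y] K y compact_imp_closed by blast
  have "a \<noteq> 0" using ab \<open>K \<noteq> {}\<close> by force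
  let ?u = "- a /\<^sub>R norm a"
  have "norm ?u = 1" using \<open>a \<noteq> 0\<close> by simp
  then obtain p where p: "p \<in> K" "support_point M ?u p" using M by blast
  then have "support_point M (- a) p"
    using support_point_scaleR[of "inverse (norm a)" M "- a"] \<open>a \<noteq> 0\<close> by simp
  then have "a \<bullet> p \<le> a \<bullet> y" using y by (simp add: support_point_def)
  then show False using ab p by force
qed

lemma translates_if_support_maps_differ_by_constant:
  assumes K0: "constant_width K0" and K1: "constant_width K1"
    and d: "\<And>u. norm u = 1 \<Longrightarrow> support_map K1 u = d + support_map K0 u"
  shows "translates K0 K1"
proof -
  have c: "compact K0" "convex K0" "K0 \<noteq> {}" "compact K1" "convex K1" "K1 \<noteq> {}"
    using K0 K1 by (auto simp: constant_width_def)
  have supp: "support_point ((+) d ` K0) u (support_map K1 u)" if "norm u = 1" for u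
    using support_map[OF K0, of u] d[OF that]
    by (auto simp: support_point_def inner_add_right)
  have mem: "support_map K1 u \<in> K1" for u
    using support_map[OF K1] by (simp add: support_point_def)
  have "K1 \<subseteq> (+) d ` K0"
  proof (rule subset_if_support_points_mem)
    show "\<exists>p\<in>(+) d ` K0. support_point K1 u p" if "norm u = 1" for u
      using support_map[OF K1, of u] supp[OF that] unfolding support_point_def by blast
  qed (simp_all add: c compact_translation convex_translation)
  moreover have "(+) d ` K0 \<subseteq> K1"
  proof (rule subset_if_support_points_mem)
    show "\<exists>p\<in>K1. support_point ((+) d ` K0) u p" if "norm u = 1" for u
      using supp[OF that] mem by blast
  qed (simp_all add: c)
  ultimately show ?thesis unfolding translates_def by blast
qed

section \<open>Corners and Minkowski combinations\<close>

lemma support_point_minkowski_combination: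
  assumes "0 < t" "t < 1" "support_point K0 u p0" "support_point K1 u p1"
  shows "support_point (minkowski_combination t K0 K1) u ((1 - t) *\<^sub>R p0 + t *\<^sub>R p1)"
  using assms unfolding support_point_def minkowski_combination_def
  by (auto simp: inner_add_right intro!: add_mono mult_left_mono)

text \<open>
  The point \<open>c\<close> is the same combination of the support points of \<open>K0\<close> and \<open>K1\<close> at \<open>u\<close> and at \<open>v\<close>.
  Moving from \<open>u\<close> to \<open>v\<close> can only lower the value of \<open>u \<bullet> _\<close> at each of these two points, while the
  combined value stays the same. So neither value drops, and uniqueness of support points
  gives the equations.
\<close>

lemma support_map_eq_if_common_support_point:
  assumes t: "0 < t" "t < 1" and K0: "constant_width K0" and K1: "constant_width K1"
    and K: "constant_width (minkowski_combination t K0 K1)"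
    and u: "norm u = 1" and v: "norm v = 1"
    and c: "support_point (minkowski_combination t K0 K1) u c"
           "support_point (minkowski_combination t K0 K1) v c"
  shows "support_map K0 u = support_map K0 v" "support_map K1 u = support_map K1 v"
proof -
  let ?p = "support_map K0" and ?q = "support_map K1"
  have p: "support_point K0 w (?p w)" and q: "support_point K1 w (?q w)" for w
    using support_map K0 K1 by auto
  have "c = (1 - t) *\<^sub>R ?p w + t *\<^sub>R ?q w"
    if "norm w = 1" "support_point (minkowski_combination t K0 K1) w c" for w
    using that support_point_minkowski_combination[OF t p q]
    by (blast intro: constant_width_support_point_unique[OF K])
  from arg_cong[OF trans[OF sym[OF this] this], of u v "(\<bullet>) u"]
  have "(1 - t) * (u \<bullet> ?p u) + t * (u \<bullet> ?q u) = (1 - t) * (u \<bullet> ?p v) + t * (u \<bullet> ?q v)"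
    using u v c by (simp add: inner_add_right)
  then have eq: "(1 - t) * (u \<bullet> ?p u - u \<bullet> ?p v) + t * (u \<bullet> ?q u - u \<bullet> ?q v) = 0"
    by (simp add: algebra_simps)
  have le: "0 \<le> u \<bullet> ?p u - u \<bullet> ?p v" "0 \<le> u \<bullet> ?q u - u \<bullet> ?q v"
    using p q by (auto simp: support_point_def)
  then have "(1 - t) * (u \<bullet> ?p u - u \<bullet> ?p v) = 0" "t * (u \<bullet> ?q u - u \<bullet> ?q v) = 0"
    using eq t add_nonneg_eq_0_iff by (smt (verit) mult_nonneg_nonneg)+
  then have "u \<bullet> ?p u = u \<bullet> ?p v" "u \<bullet> ?q u = u \<bullet> ?q v" using t by auto
  then have "support_point K0 u (?p v)" "support_point K1 u (?q v)"
    using p q unfolding support_point_def by metis+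
  then show "?p u = ?p v" "?q u = ?q v"
    using support_map_eq[OF K0 u] support_map_eq[OF K1 u] by auto
qed

text \<open>
  The sign is left open since a support point \<open>c\<close> at \<open>u\<close> determines the one at \<open>- u\<close>, which is \<open>c - u\<close>.
\<close>

definition corner_supported :: "'a::euclidean_space set \<Rightarrow> 'a set \<Rightarrow> 'a set \<Rightarrow> bool" where
  "corner_supported K V S \<longleftrightarrow>
     (\<forall>u\<in>S. \<exists>c\<in>V. support_point K u c \<or> support_point K (- u) c)"

text \<open>
  The difference of the two support maps is an even function which takes only one value on all directions
  with a given corner. Its range on \<open>S\<close> is thus finite, and it is connected by continuity.
\<close>

lemma support_map_difference_constant:
  assumes t: "0 < t" "t < 1" and K0: "constant_width K0" and K1: "constant_width K1"
    and K: "constant_width (minkowski_combination t K0 K1)"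
    and V: "finite V" "corner_supported (minkowski_combination t K0 K1) V S"
    and S: "connected S" "S \<subseteq> sphere 0 1" and uv: "u \<in> S" "v \<in> S"
  shows "support_map K1 u - support_map K0 u = support_map K1 v - support_map K0 v"
proof -
  let ?K = "minkowski_combination t K0 K1"
  define \<delta> where "\<delta> w = support_map K1 w - support_map K0 w" for w
  have norm1: "norm w = 1" if "w \<in> S" for w using that S by auto
  have \<delta>_minus: "\<delta> (- w) = \<delta> w" if "w \<in> S" for w
    using norm1[OF that] by (simp add: \<delta>_def support_map_minus K0 K1)
  \<comment> \<open>These are the unit normals at \<open>c\<close>. If there are none, the default value of \<open>SOME\<close> below merely
    enlarges a finite set.\<close>
  define A where "A c = {w. norm w = 1 \<and> support_point ?K w c}" for c
  have \<delta>_A: "\<delta> w = \<delta> w'" if "w \<in> A c" "w' \<in> A c" for w w' c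
    using support_map_eq_if_common_support_point[OF t K0 K1 K, of w w' c] that
    by (simp add: A_def \<delta>_def)
  have "\<delta> ` S \<subseteq> (\<lambda>c. \<delta> (SOME w. w \<in> A c)) ` V"
  proof safe
    fix w assume w: "w \<in> S"
    then obtain c where c: "c \<in> V" "w \<in> A c \<or> - w \<in> A c"
      using V norm1[OF w] by (auto simp: corner_supported_def A_def)
    then have "\<delta> (SOME w. w \<in> A c) = \<delta> w"
      using \<delta>_A someI[of "\<lambda>w. w \<in> A c"] \<delta>_minus[OF w] by metis
    then show "\<delta> w \<in> (\<lambda>c. \<delta> (SOME w. w \<in> A c)) ` V" using c by force
  qed
  then have "finite (\<delta> ` S)" using V finite_surj by blast
  moreover have "continuous_on S \<delta>"
    unfolding \<delta>_def using continuous_on_support_map K0 K1 S(2)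
    by (intro continuous_intros) (blast intro: continuous_on_subset)+
  then have "connected (\<delta> ` S)" using S connected_continuous_image by blast
  ultimately obtain z where "\<delta> ` S = {} \<or> \<delta> ` S = {z}"
    using connected_finite_iff_sing by blast
  then have "\<delta> u = \<delta> v" using uv by (metis empty_iff imageI singletonD)
  then show ?thesis by (simp add: \<delta>_def)
qed

text \<open>
  The sets \<open>S\<close> all contain \<open>e\<close>, so the constants for the different sets \<open>S\<close> agree.
\<close>

lemma extreme_constant_width_if_corner_supported:
  assumes K: "constant_width K"
    and S: "\<And>u. norm u = 1 \<Longrightarrow> \<exists>S V. u \<in> S \<and> e \<in> S \<and> connected S \<and> S \<subseteq> sphere 0 1 \<and>
              finite V \<and> corner_supported K V S"
  shows "extreme_constant_width K"
  unfolding extreme_constant_width_def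
proof (intro conjI K allI impI notI)
  fix t K0 K1
  assume "0 < t \<and> t < 1 \<and> constant_width K0 \<and> constant_width K1 \<and> \<not> translates K0 K1"
    and eq: "K = minkowski_combination t K0 K1"
  then have t: "0 < t" "t < 1" and K01: "constant_width K0" "constant_width K1"
    and "\<not> translates K0 K1" by auto
  moreover have "support_map K1 u = (support_map K1 e - support_map K0 e) + support_map K0 u"
    if u: "norm u = 1" for u
  proof -
    obtain S V where "u \<in> S" "e \<in> S" "connected S" "S \<subseteq> sphere 0 1" "finite V"
      "corner_supported (minkowski_combination t K0 K1) V S"
      using S[OF u] unfolding eq by blast
    then have "support_map K1 u - support_map K0 u = support_map K1 e - support_map K0 e"
      using support_map_difference_constant[OF t K01] K eq by blast
    then show ?thesis by (simp add: algebra_simps)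
  qed
  ultimately show False using translates_if_support_maps_differ_by_constant by blast
qed

section \<open>Corners of Reuleaux polygons\<close>

lemma support_point_in_frontier:
  assumes "u \<noteq> 0" "support_point K u p"
  shows "p \<in> frontier K"
proof -
  have "p \<notin> interior K"
  proof
    assume "p \<in> interior K"
    then obtain \<epsilon> where e: "\<epsilon> > 0" "cball p \<epsilon> \<subseteq> K" by (auto simp: mem_interior_cball)
    have "p + (\<epsilon> / norm u) *\<^sub>R u \<in> cball p \<epsilon>" using e assms by (simp add: dist_norm)
    then have "u \<bullet> (p + (\<epsilon> / norm u) *\<^sub>R u) \<le> u \<bullet> p"
      using e assms by (auto simp: support_point_def)
    then have "\<epsilon> / norm u * (u \<bullet> u) \<le> 0" by (simp add: inner_add_right)
    moreover have "0 < \<epsilon> / norm u * (u \<bullet> u)" using e assms by simp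
    ultimately show False by linarith
  qed
  moreover have "p \<in> closure K" using assms closure_subset by (auto simp: support_point_def)
  ultimately show ?thesis by (simp add: frontier_def)
qed

text \<open>
  The height \<open>u \<bullet> x\<close> along the arc is \<open>cos (t - \<phi>)\<close> up to a constant, where \<open>\<phi>\<close> is the angle of \<open>u\<close>. It is
  maximal on the arc at the interior parameter \<open>s\<close>, so \<open>s - \<phi>\<close> is a critical point of the cosine and not a
  minimum.
\<close>

lemma support_point_inside_arc:
  fixes C :: "(real^2) set"
  assumes s: "a < s" "s < b" and arc: "{c + vector [cos t, sin t] | t. a \<le> t \<and> t \<le> b} \<subseteq> C"
    and u: "norm u = 1" and p: "support_point C u (c + vector [cos s, sin s])"
  shows "u = vector [cos s, sin s]"
proof -
  have "(u$1)\<^sup>2 + (u$2)\<^sup>2 = 1" using u by (simp add: norm_vec_def L2_set_def sum_2)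
  then obtain \<phi> where \<phi>: "u$1 = cos \<phi>" "u$2 = sin \<phi>" using sincos_total_2pi by metis
  have u_inner: "u \<bullet> vector [cos t, sin t] = cos (t - \<phi>)" for t
    using \<phi> by (simp add: inner_vec_def sum_2 cos_diff mult.commute)
  have le: "cos (t - \<phi>) \<le> cos (s - \<phi>)" if "a \<le> t" "t \<le> b" for t
  proof -
    have "c + vector [cos t, sin t] \<in> C" using arc that by auto
    then show ?thesis using p by (auto simp: support_point_def inner_add_right u_inner dest!: bspec[of C _ "c + vector [cos t, sin t]"])
  qed
  have "- sin (s - \<phi>) = 0"
  proof (rule DERIV_local_max[where d = "min (s - a) (b - s)"])
    show "((\<lambda>t. cos (t - \<phi>)) has_real_derivative - sin (s - \<phi>)) (at s)"
      by (auto intro!: derivative_eq_intros)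
    show "\<forall>t. \<bar>s - t\<bar> < min (s - a) (b - s) \<longrightarrow> cos (t - \<phi>) \<le> cos (s - \<phi>)"
      using le by auto
  qed (use s in auto)
  then have "cos (s - \<phi>) = 1 \<or> cos (s - \<phi>) = - 1"
    using sin_cos_squared_add[of "s - \<phi>"] by (simp add: power2_eq_1_iff)
  moreover have False if m: "cos (s - \<phi>) = - 1"
  proof -
    \<comment> \<open>At a minimum the cosine would increase strictly from \<open>s\<close> to this parameter of the arc.\<close>
    define t where "t = min b (s + pi / 2)"
    have "s < t" using s pi_half_gt_zero by (simp add: t_def)
    moreover have "t \<le> b" "t \<le> s + pi / 2" by (simp_all add: t_def)
    ultimately have t: "s < t" "t - s \<le> pi / 2" "a \<le> t" "t \<le> b" using s by auto
    have "cos (t - \<phi>) = cos ((t - s) + (s - \<phi>))" by (simp add: algebra_simps)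
    also have "\<dots> = - cos (t - s)"
      using m \<open>- sin (s - \<phi>) = 0\<close> by (subst cos_add) simp
    finally have "cos (t - s) = 1"
      using le[OF t(3,4)] m by (smt (verit) cos_le_one)
    moreover have "cos (t - s) < cos 0" using t pi_gt_zero by (intro cos_monotone_0_pi) auto
    ultimately show False by simp
  qed
  ultimately have "u \<bullet> vector [cos s, sin s] = 1" using u_inner by auto
  then have "(norm (u - vector [cos s, sin s]))\<^sup>2 = 0"
    using u by (simp add: power2_norm_eq_inner inner_diff_left inner_diff_right inner_commute
        norm_eq_1) (simp add: inner_vec_def sum_2 power2_eq_square[symmetric])
  then show ?thesis by simp
qed

text \<open>
  The centres and the ends of the arcs suffice. Inside an arc with centre \<open>c\<close> the boundary point with outer
  normal \<open>u\<close> is \<open>c + u\<close>, so that the opposite boundary point is \<open>c\<close>.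
\<close>

lemma reuleaux_polygon_corners:
  assumes "reuleaux_polygon C"
  obtains V where "finite V" "corner_supported C V (sphere 0 1)"
proof -
  from assms obtain \<A> where C: "constant_width C" and A: "finite \<A>"
    "\<forall>A\<in>\<A>. unit_circular_arc A" "frontier C = \<Union>\<A>"
    by (auto simp: reuleaux_polygon_def)
  have "closed C" using C by (auto simp: constant_width_def compact_imp_closed)
  then have sub: "\<Union>\<A> \<subseteq> C" using A frontier_subset_closed by metis
  have "\<exists>W. finite W \<and> (\<forall>u p. norm u = 1 \<and> support_point C u p \<and> p \<in> A \<longrightarrow> p \<in> W \<or> p - u \<in> W)"
    if mem: "A \<in> \<A>" for A
  proof -
    obtain c a b where Aeq: "A = {c + vector [cos t, sin t] | t. a \<le> t \<and> t \<le> b}"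
      using bspec[OF A(2) mem] unfolding unit_circular_arc_def by (elim exE conjE) (rule that)
    let ?W = "{c, c + vector [cos a, sin a], c + vector [cos b, sin b]}"
    have "p \<in> ?W \<or> p - u \<in> ?W" if up: "norm u = 1" "support_point C u p" "p \<in> A" for u p
    proof -
      obtain s where s: "p = c + vector [cos s, sin s]" "a \<le> s" "s \<le> b" using up Aeq by auto
      show ?thesis
      proof (cases "s = a \<or> s = b")
        case False
        then have "u = vector [cos s, sin s]"
          using s up sub \<open>A \<in> \<A>\<close> Aeq by (intro support_point_inside_arc[of a s b c C]) auto
        then show ?thesis using s by simp
      qed (use s in auto)
    qed
    then show ?thesis by (intro exI[of _ ?W]) blast
  qed
  then obtain W where W: "\<And>A. A \<in> \<A> \<Longrightarrow> finite (W A)"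
    "\<And>A u p. \<lbrakk>A \<in> \<A>; norm u = 1; support_point C u p; p \<in> A\<rbrakk> \<Longrightarrow> p \<in> W A \<or> p - u \<in> W A"
    by metis
  show ?thesis
  proof
    show "finite (\<Union>A\<in>\<A>. W A)" using A W by auto
    show "corner_supported C (\<Union>A\<in>\<A>. W A) (sphere 0 1)"
      unfolding corner_supported_def
    proof
      fix u :: "real^2" assume "u \<in> sphere 0 1"
      then have u: "norm u = 1" by simp
      let ?p = "support_map C u"
      have p: "support_point C u ?p" by (rule support_map[OF C])
      then have "?p \<in> \<Union>\<A>" using A u support_point_in_frontier[of u C ?p] by force
      then obtain A where "A \<in> \<A>" "?p \<in> W A \<or> ?p - u \<in> W A" using W(2) u p by blast
      then show "\<exists>c\<in>\<Union>A\<in>\<A>. W A. support_point C u c \<or> support_point C (- u) c"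
        using p support_point_opposite[OF C u p] by blast
    qed
  qed
qed


section \<open>Meridian planes and bodies of revolution\<close>

definition frame :: "'a::real_inner \<Rightarrow> 'a \<Rightarrow> bool" where
  "frame a b \<longleftrightarrow> norm a = 1 \<and> norm b = 1 \<and> a \<bullet> b = 0"

text \<open>
  For orthonormal pairs this is the orthogonal projection to the plane of \<open>a\<close> and \<open>b\<close> followed by the
  isometry that sends \<open>a\<close> to \<open>c\<close> and \<open>b\<close> to \<open>d\<close>. With \<open>n, m\<close> a basis of \<open>real^2\<close> adapted to the axis of
  symmetry and \<open>w, e\<close> a basis of a meridian plane in \<open>real^3\<close>, one formula then covers the embedding
  \<open>frame_map n m w e\<close> of the plane, its adjoint \<open>frame_map w e n m\<close> (the projection to the meridian plane),
  and the reflection \<open>frame_map n m (- n) m\<close>.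
\<close>

definition frame_map :: "'a::real_inner \<Rightarrow> 'a \<Rightarrow> 'b::real_inner \<Rightarrow> 'b \<Rightarrow> 'a \<Rightarrow> 'b" where
  "frame_map a b c d x = (x \<bullet> a) *\<^sub>R c + (x \<bullet> b) *\<^sub>R d"

lemma frame_inner:
  assumes "frame a b"
  shows "a \<bullet> a = 1" "b \<bullet> b = 1" "a \<bullet> b = 0" "b \<bullet> a = 0"
  using assms by (auto simp: frame_def norm_eq_1 inner_commute)

lemma frame_map_simps:
  "frame_map a b c d (x + y) = frame_map a b c d x + frame_map a b c d y"
  "frame_map a b c d (x - y) = frame_map a b c d x - frame_map a b c d y"
  "frame_map a b c d (- x) = - frame_map a b c d x"
  "frame_map a b c d (r *\<^sub>R x) = r *\<^sub>R frame_map a b c d x"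
  by (simp_all add: frame_map_def inner_add_left inner_diff_left algebra_simps)

lemma continuous_on_frame_map [continuous_intros]:
  "continuous_on S g \<Longrightarrow> continuous_on S (\<lambda>x. frame_map a b c d (g x))"
  unfolding frame_map_def by (intro continuous_intros)

lemma inner_frame_map: "frame_map a b c d x \<bullet> y = x \<bullet> frame_map c d a b y"
  by (simp add: frame_map_def inner_add_left inner_add_right inner_commute)

lemma frame_map_frame_map:
  assumes "frame c d"
  shows "frame_map c d a' b' (frame_map a b c d x) = frame_map a b a' b' x"
  using frame_inner[OF assms] by (simp add: frame_map_def inner_add_left)

lemma frame_map_plane:
  fixes a b x :: "real^2"
  assumes "frame a b"
  shows "frame_map a b a b x = x"
proof -
  define A :: "real^2^2" where "A = vector [a, b]"
  have "A ** transpose A = mat 1"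
    using frame_inner[OF assms]
    by (simp add: A_def matrix_matrix_mult_def transpose_def mat_def vec_eq_iff forall_2 sum_2
        inner_vec_def)
  then have "transpose A ** A = mat 1" by (simp add: matrix_left_right_inverse)
  then have "transpose A *v (A *v x) = x" by (simp add: matrix_vector_mul_assoc)
  moreover have "transpose A *v (A *v x) = frame_map a b a b x"
    by (simp add: A_def matrix_vector_mult_def transpose_def vec_eq_iff forall_2 sum_2
        frame_map_def inner_vec_def algebra_simps)
  ultimately show ?thesis by simp
qed

lemma norm_frame_map_plane:
  fixes a b x :: "real^2"
  assumes "frame a b" "frame c d"
  shows "norm (frame_map a b c d x) = norm x"
  using assms by (simp add: norm_eq inner_frame_map frame_map_frame_map frame_map_plane)

lemma frame_through_vector:
  fixes e y :: "real^3"
  assumes e: "norm e = 1"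
  obtains w where "frame w e" "frame_map w e w e y = y"
proof (cases "y - (y \<bullet> e) *\<^sub>R e = 0")
  case True
  have "2 \<le> DIM(real^3)" by simp
  then obtain x where x: "x \<noteq> 0" "orthogonal e x" by (rule orthogonal_to_vector_exists)
  let ?w = "x /\<^sub>R norm x"
  have w: "frame ?w e" using x e by (simp add: frame_def orthogonal_def inner_commute)
  have "y = (y \<bullet> e) *\<^sub>R e" using True by simp
  then have "y \<bullet> ?w = 0" using frame_inner[OF w] by (metis inner_scaleR_left mult_zero_right)
  then show ?thesis using that[OF w] True by (simp add: frame_map_def)
next
  case False
  define h where "h = y - (y \<bullet> e) *\<^sub>R e"
  have h: "norm h \<noteq> 0" "y = h + (y \<bullet> e) *\<^sub>R e" using False by (simp_all add: h_def)
  have he: "h \<bullet> e = 0" using e by (simp add: h_def inner_diff_left norm_eq_1)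
  let ?w = "h /\<^sub>R norm h"
  have w: "frame ?w e" using h(1) he e by (simp add: frame_def)
  have "y \<bullet> h = h \<bullet> h"
    by (subst h(2)) (simp add: inner_add_left inner_commute[of e h] he)
  then have "(y \<bullet> ?w) *\<^sub>R ?w = h"
    using h(1) by (simp add: dot_square_norm power2_eq_square field_simps)
  then have "frame_map ?w e ?w e y = y" unfolding frame_map_def using h(2) by simp
  then show ?thesis using that[OF w] by blast
qed

text \<open>
  The union of the copies of \<open>C\<close> in all meridian half-planes and their opposites: \<open>q\<close> and \<open>p\<close> are corresponding
  points of the axes in \<open>real^2\<close> and \<open>real^3\<close>, and \<open>m\<close> and \<open>e\<close> the directions of these axes.
\<close>

definition revolve ::
    "real^2 \<Rightarrow> real^2 \<Rightarrow> real^2 \<Rightarrow> real^3 \<Rightarrow> real^3 \<Rightarrow> (real^2) set \<Rightarrow> (real^3) set" where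
  "revolve q n m p e C = {p + frame_map n m w e (x - q) | w x. frame w e \<and> x \<in> C}"

text \<open>
  Projecting the copy of \<open>C\<close> in the meridian plane of \<open>w'\<close> to that of \<open>w\<close> multiplies the signed distance from the axis
  by \<open>w' \<bullet> w\<close>, a number between \<open>-1\<close> and \<open>1\<close>. The result is a convex combination of a point of \<open>C\<close> and its
  mirror image.
\<close>

lemma revolve_projection:
  assumes C: "convex C" and sym: "\<forall>x\<in>C. q + frame_map n m (- n) m (x - q) \<in> C"
    and nm: "frame n m" and w: "frame w e" and y: "y \<in> revolve q n m p e C"
  shows "q + frame_map w e n m (y - p) \<in> C"
proof -
  obtain w' x where w': "frame w' e" and x: "x \<in> C" and y: "y = p + frame_map n m w' e (x - q)"
    using y by (auto simp: revolve_def)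
  let ?s = "w' \<bullet> w"
  have "\<bar>?s\<bar> \<le> norm w' * norm w" by (rule Cauchy_Schwarz_ineq2)
  then have s: "0 \<le> (1 + ?s) / 2" "0 \<le> (1 - ?s) / 2" "(1 + ?s) / 2 + (1 - ?s) / 2 = 1"
    using w w' by (auto simp: frame_def field_simps)
  define a b where "a = (x - q) \<bullet> n" and "b = (x - q) \<bullet> m"
  have "x - q = a *\<^sub>R n + b *\<^sub>R m"
    using frame_map_plane[OF nm, of "x - q"] by (simp add: frame_map_def a_def b_def)
  then have x_eq: "x = q + (a *\<^sub>R n + b *\<^sub>R m)" by (simp add: algebra_simps)
  have "q + (a *\<^sub>R (- n) + b *\<^sub>R m) \<in> C"
    using bspec[OF sym x] by (simp add: frame_map_def a_def b_def)
  from convexD[OF C x this s]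
  have "((1 + ?s) / 2) *\<^sub>R (q + (a *\<^sub>R n + b *\<^sub>R m))
      + ((1 - ?s) / 2) *\<^sub>R (q + (a *\<^sub>R (- n) + b *\<^sub>R m)) \<in> C"
    by (subst (asm) x_eq)
  also have "((1 + ?s) / 2) *\<^sub>R (q + (a *\<^sub>R n + b *\<^sub>R m))
      + ((1 - ?s) / 2) *\<^sub>R (q + (a *\<^sub>R (- n) + b *\<^sub>R m)) = q + ((?s * a) *\<^sub>R n + b *\<^sub>R m)"
    by (simp add: vec_eq_iff field_simps)
  also have "(?s * a) *\<^sub>R n + b *\<^sub>R m = frame_map w e n m (y - p)"
    using frame_inner[OF w] frame_inner[OF w']
    by (simp add: y frame_map_def inner_add_left a_def b_def)
  finally show ?thesis .
qed

text \<open>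
  As an intersection of preimages of \<open>C\<close> under affine maps, the body inherits convexity and closedness from \<open>C\<close>.
\<close>

lemma revolve_eq_projections:
  assumes C: "convex C" and sym: "\<forall>x\<in>C. q + frame_map n m (- n) m (x - q) \<in> C"
    and nm: "frame n m" and e: "norm e = 1"
  shows "revolve q n m p e C = {y. \<forall>w. frame w e \<longrightarrow> q + frame_map w e n m (y - p) \<in> C}"
    (is "_ = ?R")
proof (intro equalityI subsetI)
  fix y assume "y \<in> revolve q n m p e C"
  then show "y \<in> ?R" using revolve_projection[OF C sym nm] by blast
next
  fix y assume y: "y \<in> ?R"
  obtain w where w: "frame w e" "frame_map w e w e (y - p) = y - p"
    using frame_through_vector[OF e] by blast
  then have "y = p + frame_map n m w e (q + frame_map w e n m (y - p) - q)"
    using nm by (simp add: frame_map_frame_map)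
  then show "y \<in> revolve q n m p e C" unfolding revolve_def using w(1) y by blast
qed

text \<open>
  For \<open>u\<close> in a plane through the axis, the maximum of \<open>u \<bullet> _\<close> over the body is the maximum over its
  projection to this plane. The projection is the copy of \<open>C\<close> in the plane, which is also a subset of the body.
\<close>

lemma support_point_revolve:
  assumes C: "convex C" and sym: "\<forall>x\<in>C. q + frame_map n m (- n) m (x - q) \<in> C"
    and nm: "frame n m" and w: "frame w e" and c: "support_point C v c"
  shows "support_point (revolve q n m p e C) (frame_map n m w e v) (p + frame_map n m w e (c - q))"
  unfolding support_point_def
proof (intro conjI ballI)
  let ?J = "frame_map n m w e" and ?P = "frame_map w e n m"
  show "p + ?J (c - q) \<in> revolve q n m p e C"
    using c w by (auto simp: revolve_def support_point_def)
  fix y assume "y \<in> revolve q n m p e C"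
  then have "q + ?P (y - p) \<in> C" by (rule revolve_projection[OF C sym nm w])
  then have "v \<bullet> (q + ?P (y - p)) \<le> v \<bullet> c" using c by (simp add: support_point_def)
  then have "v \<bullet> ?P (y - p) \<le> v \<bullet> (c - q)" by (simp add: inner_add_right inner_diff_right)
  also have "c - q = ?P (?J (c - q))" using w nm by (simp add: frame_map_frame_map frame_map_plane)
  finally have "?J v \<bullet> (y - p) \<le> ?J v \<bullet> ?J (c - q)" by (simp add: inner_frame_map)
  then show "?J v \<bullet> y \<le> ?J v \<bullet> (p + ?J (c - q))"
    by (simp add: inner_add_right inner_diff_right)
qed

lemma meridian_direction:
  fixes n m :: "real^2" and e u :: "real^3"
  assumes nm: "frame n m" and e: "norm e = 1" and u: "norm u = 1"
  obtains w v where "frame w e" "norm v = 1" "frame_map n m w e v = u"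
proof -
  obtain w where w: "frame w e" "frame_map w e w e u = u"
    using frame_through_vector[OF e] by blast
  let ?v = "frame_map w e n m u"
  have "frame_map n m w e ?v = u" using w nm by (simp add: frame_map_frame_map)
  moreover from this have "norm ?v = 1" using norm_frame_map_plane[OF nm w(1), of ?v] u by simp
  ultimately show ?thesis using that w(1) by blast
qed

lemma compact_convex_revolve:
  assumes C: "convex C" "compact C" and sym: "\<forall>x\<in>C. q + frame_map n m (- n) m (x - q) \<in> C"
    and nm: "frame n m" and e: "norm e = 1"
  shows "compact (revolve q n m p e C)" "convex (revolve q n m p e C)"
proof -
  let ?f = "\<lambda>w y. q + frame_map w e n m (y - p)"
  have eq: "revolve q n m p e C = (\<Inter>w\<in>{w. frame w e}. ?f w -` C)"
    using revolve_eq_projections[OF C(1) sym nm e] by auto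
  have "closed (?f w -` C)" for w
    using C by (intro continuous_closed_vimage) (auto intro!: compact_imp_closed
      simp: frame_map_def intro!: continuous_intros)
  then have "closed (revolve q n m p e C)" unfolding eq by blast
  moreover have "bounded (revolve q n m p e C)"
  proof -
    obtain r where r: "\<forall>x\<in>C. dist q x \<le> r"
      using compact_imp_bounded[OF C(2)] bounded_any_center by blast
    have "dist p y \<le> r" if y: "y \<in> revolve q n m p e C" for y
    proof -
      obtain w x where "frame w e" "x \<in> C" "y = p + frame_map n m w e (x - q)"
        using y by (auto simp: revolve_def)
      then have "dist p y = dist q x"
        using norm_frame_map_plane[OF nm, of w e "x - q"] by (simp add: dist_norm norm_minus_commute)
      then show ?thesis using r \<open>x \<in> C\<close> by simp
    qed
    then show ?thesis unfolding bounded_def by blast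
  qed
  ultimately show "compact (revolve q n m p e C)" by (simp add: compact_eq_bounded_closed)
  show "convex (revolve q n m p e C)"
    unfolding eq
  proof (intro convex_INT ballI convexI)
    fix w x y and s t :: real
    assume xy: "x \<in> ?f w -` C" "y \<in> ?f w -` C" and st: "0 \<le> s" "0 \<le> t" "s + t = 1"
    have "q + frame_map w e n m (s *\<^sub>R x + t *\<^sub>R y - p)
        = (s + t) *\<^sub>R q + frame_map w e n m (s *\<^sub>R x + t *\<^sub>R y - (s + t) *\<^sub>R p)"
      using st by simp
    also have "\<dots> = s *\<^sub>R ?f w x + t *\<^sub>R ?f w y"
      by (simp add: frame_map_simps algebra_simps)
    also have "\<dots> \<in> C" using convexD[OF C(1)] xy st by simp
    finally show "s *\<^sub>R x + t *\<^sub>R y \<in> ?f w -` C" by simp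
  qed
qed

text \<open>
  Every direction lies in a plane through the axis, and the opposite boundary points there are those of \<open>C\<close>.
\<close>

lemma constant_width_revolve:
  assumes C: "constant_width C" and sym: "\<forall>x\<in>C. q + frame_map n m (- n) m (x - q) \<in> C"
    and nm: "frame n m" and e: "norm e = 1"
  shows "constant_width (revolve q n m p e C)"
proof (rule constant_widthI)
  have c: "compact C" "convex C" "C \<noteq> {}" using C by (auto simp: constant_width_def)
  show "compact (revolve q n m p e C)" "convex (revolve q n m p e C)"
    using compact_convex_revolve[OF c(2,1) sym nm e] by auto
  obtain w where "frame w e" using frame_through_vector[OF e] by blast
  then show "revolve q n m p e C \<noteq> {}" using c by (auto simp: revolve_def)
  fix u :: "real^3" assume "norm u = 1"
  then obtain w v where w: "frame w e" and v: "norm v = 1" and u: "frame_map n m w e v = u"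
    by (rule meridian_direction[OF nm e])
  let ?c = "support_map C v"
  have c1: "support_point C v ?c" by (rule support_map[OF C])
  have c2: "support_point C (- v) (?c - v)" by (rule support_point_opposite[OF C v c1])
  note supp = support_point_revolve[OF c(2) sym nm w]
  have "frame_map n m w e (?c - v - q) = frame_map n m w e (?c - q) - u"
    by (simp add: u[symmetric] frame_map_simps)
  then show "\<exists>x. support_point (revolve q n m p e C) u x \<and>
      support_point (revolve q n m p e C) (- u) (x - u)"
    using supp[OF c1, of p] supp[OF c2, of p]
    by (intro exI[of _ "p + frame_map n m w e (?c - q)"]) (simp add: u frame_map_simps(3) add_diff_eq)
qed

text \<open>
  The great circles through \<open>e\<close> are the images of the circle of directions in \<open>real^2\<close>, and the copies of
  the corners of \<open>C\<close> serve each of them.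
\<close>

lemma extreme_constant_width_revolve:
  assumes C: "reuleaux_polygon C" and sym: "\<forall>x\<in>C. q + frame_map n m (- n) m (x - q) \<in> C"
    and nm: "frame n m" and e: "norm e = 1"
  shows "extreme_constant_width (revolve q n m p e C)"
proof (rule extreme_constant_width_if_corner_supported)
  have C': "constant_width C" "convex C"
    using C by (auto simp: reuleaux_polygon_def constant_width_def)
  show "constant_width (revolve q n m p e C)" by (rule constant_width_revolve[OF C'(1) sym nm e])
  obtain V where V: "finite V" "corner_supported C V (sphere 0 1)"
    using reuleaux_polygon_corners[OF C] by blast
  fix u :: "real^3" assume "norm u = 1"
  then obtain w v where w: "frame w e" and v: "norm v = 1" and u: "frame_map n m w e v = u"
    by (rule meridian_direction[OF nm e])
  let ?J = "frame_map n m w e"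
  let ?S = "?J ` sphere 0 1" and ?V = "(\<lambda>c. p + ?J (c - q)) ` V"
  have "u \<in> ?S" using v u by (auto intro!: rev_image_eqI[of v])
  moreover have "?J m = e" "norm m = 1" using frame_inner[OF nm] nm by (auto simp: frame_map_def frame_def)
  then have "e \<in> ?S" by (auto intro!: rev_image_eqI[of m])
  moreover have "connected ?S"
    by (intro connected_continuous_image connected_sphere continuous_intros) simp
  moreover have "?S \<subseteq> sphere 0 1" using norm_frame_map_plane[OF nm w] by auto
  moreover have "corner_supported (revolve q n m p e C) ?V ?S"
    unfolding corner_supported_def
  proof
    fix x assume "x \<in> ?S"
    then obtain y where y: "y \<in> sphere 0 1" "x = ?J y" by auto
    then obtain c where c: "c \<in> V" "support_point C y c \<or> support_point C (- y) c"
      using V(2) unfolding corner_supported_def by blast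
    then show "\<exists>c\<in>?V. support_point (revolve q n m p e C) x c \<or> support_point (revolve q n m p e C) (- x) c"
      using support_point_revolve[OF C'(2) sym nm w, of y c p]
        support_point_revolve[OF C'(2) sym nm w, of "- y" c p] y(2)
      by (auto simp: frame_map_simps(3))
  qed
  ultimately show "\<exists>S V. u \<in> S \<and> e \<in> S \<and> connected S \<and> S \<subseteq> sphere 0 1 \<and> finite V \<and>
      corner_supported (revolve q n m p e C) V S"
    using V(1) by (intro exI[of _ ?S] exI[of _ ?V]) auto
qed

section \<open>Coordinates adapted to the axis\<close>

lemma line_parametrization:
  assumes "line L"
  obtains q m where "norm m = 1" "L = range (\<lambda>z. q + z *\<^sub>R m)"
proof -
  have L: "affine L" "aff_dim L = 1" using assms by (auto simp: line_def)
  then have "L \<noteq> {}" "\<nexists>a. L = {a}" by auto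
  then obtain a b where ab: "a \<in> L" "b \<in> L" "a \<noteq> b" by blast
  have "affine hull {a, b} = L"
  proof (rule affine_dim_equal)
    show "affine hull {a, b} \<subseteq> L" using L ab by (intro hull_minimal) auto
  qed (use L ab in simp_all)
  then have L_eq: "L = range (\<lambda>z. a + z *\<^sub>R (b - a))" by (simp add: affine_hull_2_alt)
  let ?m = "(b - a) /\<^sub>R norm (b - a)"
  have "range (\<lambda>z. a + z *\<^sub>R (b - a)) = range (\<lambda>z. a + z *\<^sub>R ?m)"
  proof (intro equalityI subsetI; elim rangeE)
    fix x z assume "x = a + z *\<^sub>R (b - a)"
    then have "x = a + (z * norm (b - a)) *\<^sub>R ?m" using ab by simp
    then show "x \<in> range (\<lambda>z. a + z *\<^sub>R ?m)" by blast
  next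
    fix x z assume "x = a + z *\<^sub>R ?m"
    then have "x = a + (z / norm (b - a)) *\<^sub>R (b - a)" by (simp add: divide_inverse)
    then show "x \<in> range (\<lambda>z. a + z *\<^sub>R (b - a))" by blast
  qed
  then have "L = range (\<lambda>z. a + z *\<^sub>R ?m)" using L_eq by metis
  moreover have "norm ?m = 1" using ab by simp
  ultimately show ?thesis using that by blast
qed

lemma reflection_line:
  fixes n m q :: "real^2"
  assumes nm: "frame n m"
  shows "reflection (range (\<lambda>z. q + z *\<^sub>R m)) x = q + frame_map n m (- n) m (x - q)"
proof -
  let ?L = "range (\<lambda>z. q + z *\<^sub>R m)"
  define a b where "a = (x - q) \<bullet> n" and "b = (x - q) \<bullet> m"
  have "x - q = a *\<^sub>R n + b *\<^sub>R m"
    using frame_map_plane[OF nm, of "x - q"] by (simp add: frame_map_def a_def b_def)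
  then have x_eq: "x = q + a *\<^sub>R n + b *\<^sub>R m" by (simp add: algebra_simps)
  have "?L = affine hull {q, q + m}" by (simp add: affine_hull_2_alt)
  then have L: "convex ?L" "closed ?L" by (simp_all add: affine_imp_convex)
  have "closest_point ?L x = q + b *\<^sub>R m"
  proof (rule closest_point_unique[symmetric, OF L])
    have "dist x (q + b *\<^sub>R m) \<le> dist x (q + z *\<^sub>R m)" for z
    proof -
      have "x - (q + z *\<^sub>R m) = a *\<^sub>R n + (b - z) *\<^sub>R m" for z
        by (simp add: x_eq algebra_simps)
      then have "(dist x (q + z *\<^sub>R m))\<^sup>2 = a\<^sup>2 + (b - z)\<^sup>2" for z
        using frame_inner[OF nm]
        by (simp add: dist_norm power2_norm_eq_inner inner_add_left inner_add_right)
          (simp add: power2_eq_square)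
      then have "(dist x (q + b *\<^sub>R m))\<^sup>2 \<le> (dist x (q + z *\<^sub>R m))\<^sup>2" by simp
      then show ?thesis by (rule power2_le_imp_le) simp
    qed
    then show "\<forall>y\<in>?L. dist x (q + b *\<^sub>R m) \<le> dist x y" by blast
  qed (rule rangeI)
  then have "reflection ?L x = 2 *\<^sub>R (q + b *\<^sub>R m) - (q + a *\<^sub>R n + b *\<^sub>R m)"
    by (simp add: reflection_def x_eq[symmetric])
  also have "\<dots> = q + (a *\<^sub>R (- n) + b *\<^sub>R m)" by (simp add: vec_eq_iff)
  also have "a *\<^sub>R (- n) + b *\<^sub>R m = frame_map n m (- n) m (x - q)"
    by (simp add: frame_map_def a_def b_def)
  finally show ?thesis .
qed

text \<open>
  An isometry preserves inner products of differences by polarization. Hence the increment of \<open>f\<close> along a vector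
  and its projection to the span of the increments along \<open>n\<close> and \<open>m\<close> have the same norm, and so coincide.
\<close>

lemma isometry_frame:
  fixes f :: "real^2 \<Rightarrow> 'a::real_inner"
  assumes f: "\<And>x y. dist (f x) (f y) = dist x y" and nm: "frame n m"
  obtains a e where "frame a e" "\<And>x. f x = f q + frame_map n m a e (x - q)"
proof -
  define g where "g x = f (q + x) - f q" for x
  have "norm (g x - g y) = norm (x - y)" for x y
    using f[of "q + x" "q + y"] by (simp add: g_def dist_norm)
  moreover have "norm (g x) = norm x" for x
    using f[of "q + x" q] by (simp add: g_def dist_norm)
  ultimately have "(norm (g x - g y))\<^sup>2 = (norm (x - y))\<^sup>2" "(norm (g x))\<^sup>2 = (norm x)\<^sup>2" for x y
    by simp_all
  then have inner: "g x \<bullet> g y = x \<bullet> y" for x y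
    by (simp add: power2_norm_eq_inner inner_diff_left inner_diff_right inner_commute)
  have "frame (g n) (g m)" using nm inner by (simp add: frame_def norm_eq_1)
  moreover have "f x = f q + frame_map n m (g n) (g m) (x - q)" for x
  proof -
    define y where "y = x - q"
    have "y \<bullet> y = y \<bullet> frame_map n m n m y" using nm by (simp add: frame_map_plane)
    then have "y \<bullet> y = (y \<bullet> n)\<^sup>2 + (y \<bullet> m)\<^sup>2"
      by (simp add: frame_map_def inner_add_right power2_eq_square)
    moreover have "(norm (g y - frame_map n m (g n) (g m) y))\<^sup>2 = y \<bullet> y - ((y \<bullet> n)\<^sup>2 + (y \<bullet> m)\<^sup>2)"
      using frame_inner[OF nm]
      by (simp add: power2_norm_eq_inner frame_map_def inner_diff_left inner_diff_right
          inner_add_left inner_add_right inner inner_commute) (simp add: power2_eq_square)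
    ultimately have "g y = frame_map n m (g n) (g m) y" by simp
    then show ?thesis by (simp add: g_def y_def algebra_simps)
  qed
  ultimately show ?thesis using that by blast
qed

text \<open>
  Completing \<open>x, e\<close> to the positively oriented basis \<open>x, e \<times> x, e\<close> makes the matrix that maps one basis to the other
  a rotation and not only an orthogonal matrix.
\<close>

lemma rotation_between_frames:
  assumes a: "frame a e" and w: "frame w e"
  obtains A :: "real^3^3" where "rotation_matrix A" "A *v a = w" "A *v e = e"
proof -
  define M :: "real^3 \<Rightarrow> real^3^3" where "M x = vector [x, cross3 e x, e]" for x
  have dots: "x \<bullet> x = 1" "e \<bullet> e = 1" "x \<bullet> e = 0" "e \<bullet> x = 0" "cross3 e x \<bullet> cross3 e x = 1"
    if "frame x e" for x
    using frame_inner[OF that] by (auto simp: dot_cross)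
  have M: "orthogonal_matrix (M x)" if "frame x e" for x
  proof -
    have "M x ** transpose (M x) = mat 1"
      using dots[OF that] dot_cross_self[of x e]  dot_cross_self[of e x]
      by (simp add: M_def matrix_matrix_mult_def transpose_def mat_def vec_eq_iff forall_3 sum_3
          inner_vec_def)
    then show ?thesis by (simp add: orthogonal_matrix matrix_left_right_inverse)
  qed
  have M_x: "M x *v x = vector [1, 0, 0]" "M x *v e = vector [0, 0, 1]" if "frame x e" for x
    using dots[OF that] dot_cross_self[of x e] dot_cross_self[of e x]
    by (simp_all add: M_def matrix_vector_mult_def vec_eq_iff forall_3 sum_3 inner_vec_def)
  have det: "det (M x) = 1" if "frame x e" for x
  proof -
    have "cross3 (cross3 e x) e = x"
      using dots[OF that] cross_skew[of "cross3 e x" e] Lagrange[of e e x] by simp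
    then show ?thesis using dots[OF that] by (simp add: M_def dot_cross_det[symmetric])
  qed
  have inv: "transpose (M w) *v (M w *v y) = y" for y
    using M[OF w] by (simp add: orthogonal_matrix matrix_vector_mul_assoc)
  show ?thesis
  proof
    show "rotation_matrix (transpose (M w) ** M a)"
      unfolding rotation_matrix_def using M[OF a] M[OF w] det[OF a] det[OF w]
      by (simp add: orthogonal_matrix_mul orthogonal_matrix_transpose det_mul)
    show "(transpose (M w) ** M a) *v a = w"
      using M_x[OF a] M_x[OF w] inv[of w] by (simp add: matrix_vector_mul_assoc[symmetric])
    show "(transpose (M w) ** M a) *v e = e"
      using M_x[OF a] M_x[OF w] inv[of e] by (simp add: matrix_vector_mul_assoc[symmetric])
  qed
qed

text \<open>
  A rotation that fixes the axis pointwise has a linear part that fixes \<open>e\<close>. It is thus determined on the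
  plane of \<open>f\<close> by the image of \<open>a\<close>, which can be any unit vector orthogonal to \<open>e\<close>.
\<close>

lemma body_of_revolution_eq_revolve:
  fixes f :: "real^2 \<Rightarrow> real^3"
  assumes nm: "frame n m" and ae: "frame a e"
    and f: "\<And>x. f x = f q + frame_map n m a e (x - q)"
  shows "body_of_revolution (f ` range (\<lambda>z. q + z *\<^sub>R m)) (f ` C) = revolve q n m (f q) e C"
    (is "body_of_revolution ?L _ = ?R")
proof (intro equalityI subsetI)
  have axis: "f (q + z *\<^sub>R m) = f q + z *\<^sub>R e" for z
    using frame_inner[OF nm] by (subst f) (simp add: frame_map_def)
  {
    fix y assume "y \<in> body_of_revolution ?L (f ` C)"
    then obtain T x where T: "rotation_about ?L T" and x: "x \<in> C" and y: "y = T (f x)"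
      by (auto simp: body_of_revolution_def)
    from T obtain A p where A: "rotation_matrix A" and T_eq: "T = (\<lambda>x. p + A *v (x - p))"
      and fixed: "\<And>z. T (f (q + z *\<^sub>R m)) = f (q + z *\<^sub>R m)"
      by (auto simp: rotation_about_def)
    have T_diff: "T y - T z = A *v (y - z)" for y z
      by (simp add: T_eq matrix_vector_mult_diff_distrib)
    have "T (f q) = f q" "T (f q + e) = f q + e"
      using fixed[of 0] fixed[of 1] axis[of 1] by simp_all
    then have Ae: "A *v e = e" using T_diff[of "f q + e" "f q"] by simp
    have A_inner: "(A *v y) \<bullet> (A *v z) = y \<bullet> z" for y z
      using A by (metis rotation_matrix_def orthogonal_transformation_def
          orthogonal_transformation_matrix matrix_of_matrix_vector_mul matrix_vector_mul_linear)
    have "frame (A *v a) e"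
      using ae A_inner[of a a] A_inner[of a e] by (simp add: frame_def norm_eq_1 Ae)
    moreover have "y = f q + frame_map n m (A *v a) e (x - q)"
    proof -
      have "y = f q + A *v (f x - f q)" using T_diff[of "f x" "f q"] \<open>T (f q) = f q\<close> y
        by (simp add: algebra_simps)
      also have "f x - f q = frame_map n m a e (x - q)" by (subst f) simp
      also have "A *v \<dots> = frame_map n m (A *v a) e (x - q)"
        by (simp add: frame_map_def matrix_vector_right_distrib matrix_vector_mult_scaleR Ae)
      finally show ?thesis .
    qed
    ultimately show "y \<in> ?R" using x unfolding revolve_def by blast
  }
  {
    fix y assume "y \<in> ?R"
    then obtain w x where w: "frame w e" and x: "x \<in> C" and y: "y = f q + frame_map n m w e (x - q)"
      by (auto simp: revolve_def)
    obtain A :: "real^3^3" where A: "rotation_matrix A" "A *v a = w" "A *v e = e"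
      using rotation_between_frames[OF ae w] by blast
    let ?T = "\<lambda>x. f q + A *v (x - f q)"
    have "\<forall>x\<in>?L. ?T x = x" by (auto simp: axis matrix_vector_mult_scaleR A)
    then have "rotation_about ?L ?T" using A(1) unfolding rotation_about_def by blast
    moreover have "y = ?T (f x)"
      using A(2,3) y by (subst f)
        (simp add: frame_map_def matrix_vector_right_distrib matrix_vector_mult_scaleR)
    ultimately show "y \<in> body_of_revolution ?L (f ` C)"
      using x unfolding body_of_revolution_def
      by (intro CollectI exI[of _ ?T] exI[of _ "f x"] conjI imageI)
  }
qed

theorem theoremB:
  fixes C L :: "(real^2) set" and f :: "real^2 \<Rightarrow> real^3"
  assumes "reuleaux_polygon C"
    and "line L"
    and "symmetric_about L C"
    and "\<And>x y. dist (f x) (f y) = dist x y"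
  shows "extreme_constant_width (body_of_revolution (f ` L) (f ` C))"
proof -
  obtain q m where m: "norm m = 1" and L: "L = range (\<lambda>z. q + z *\<^sub>R m)"
    using line_parametrization[OF assms(2)] by blast
  define n :: "real^2" where "n = vector [- m$2, m$1]"
  have nm: "frame n m"
    using m by (simp add: frame_def n_def norm_eq_1 inner_vec_def sum_2)
  obtain a e where ae: "frame a e" and f: "\<And>x. f x = f q + frame_map n m a e (x - q)"
    using isometry_frame[OF assms(4) nm] by blast
  have "\<forall>x\<in>C. q + frame_map n m (- n) m (x - q) \<in> C"
    using assms(3) reflection_line[OF nm, of q] by (auto simp: symmetric_about_def L)
  moreover have "norm e = 1" using ae by (simp add: frame_def)
  ultimately have "extreme_constant_width (revolve q n m (f q) e C)"
    using extreme_constant_width_revolve[OF assms(1)] nm by blast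
  then show ?thesis by (simp add: L body_of_revolution_eq_revolve[OF nm ae f])
qed

end
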